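(* Let $k\ge 3$ and $e\ge 3$. If there exists a strongly equitable $k$-chromatic $e$-star system of order $n_0\equiv 0\pmod{2e}$, then there exists, for some $n\equiv 0\pmod{2e}$, a strongly equitable uniquely $k$-chromatic $e$-star system of order $n$.
   Context: An $e$-star is the complete bipartite graph $K_{1,e}$. An $e$-star system of order $n$ is a pair $(V,\mathcal B)$ where $|V|=n$ and $\mathcal B$ is a set of $e$-stars (subgraphs of the complete graph $K_n$ on $V$) whose edge sets partition the edge set of $K_n$. An $e$-star system is $k$-colourable if $V$ can be partitioned into $k$ sets (colour classes) such that no star in $\mathcal B$ has all its vertices in the same class; it is $k$-chromatic if it is $k$-colourable but not $(k-1)$-colourable. It is uniquely $k$-colourable if any two $k$-colourings differ only by a permutation of the colours. A colouring is strongly equitable if all colour classes have the same size. A strongly equitable (uniquely) $k$-chromatic system is a (uniquely colourable) $k$-chromatic system admitting a strongly equitable $k$-colouring. *)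

theory Defs
  imports "HOL-Number_Theory.Cong" "HOL-Combinatorics.Permutations"
begin

text \<open>A graph is a pair of a vertex set and a set of edges, each edge being a two-element set.\<close>

type_synonym 'a graph = "'a set \<times> 'a set set"

abbreviation verts :: "'a graph \<Rightarrow> 'a set" where
  "verts G \<equiv> fst G"

abbreviation edges :: "'a graph \<Rightarrow> 'a set set" where
  "edges G \<equiv> snd G"

definition complete_graph :: "'a set \<Rightarrow> 'a graph" where
  "complete_graph V = (V, {{x, y} | x y. x \<in> V \<and> y \<in> V \<and> x \<noteq> y})"

definition subgraph :: "'a graph \<Rightarrow> 'a graph \<Rightarrow> bool" where
  "subgraph H G \<longleftrightarrow> verts H \<subseteq> verts G \<and> edges H \<subseteq> edges G"

definition is_star :: "nat \<Rightarrow> 'a graph \<Rightarrow> bool" where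
  "is_star e S \<longleftrightarrow>
     (\<exists>c L. finite L \<and> card L = e \<and> c \<notin> L \<and> S = (insert c L, {{c, x} | x. x \<in> L}))"

definition star_system :: "nat \<Rightarrow> nat \<Rightarrow> 'a set \<Rightarrow> 'a graph set \<Rightarrow> bool" where
  "star_system e n V B \<longleftrightarrow>
     finite V \<and> card V = n \<and>
     (\<forall>S\<in>B. is_star e S \<and> subgraph S (complete_graph V)) \<and>
     pairwise (\<lambda>S T. disjnt (edges S) (edges T)) B \<and>
     (\<Union>S\<in>B. edges S) = edges (complete_graph V)"

definition colour_class :: "'a set \<Rightarrow> ('a \<Rightarrow> nat) \<Rightarrow> nat \<Rightarrow> 'a set" where
  "colour_class V c i = {x \<in> V. c x = i}"

text \<open>A partition of \<open>V\<close> into \<open>k\<close> colour classes is given by a map from \<open>V\<close> to the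
  colours \<open>0, \<dots>, k - 1\<close>. Classes may be empty. For \<open>k\<close>-chromatic systems of stars with at least
  one edge this makes no difference: a \<open>k\<close>-colouring with an empty class is a
  \<open>(k - 1)\<close>-colouring, and an empty class can be filled by splitting a class with at least two
  vertices.\<close>

definition colouring :: "nat \<Rightarrow> 'a set \<Rightarrow> 'a graph set \<Rightarrow> ('a \<Rightarrow> nat) \<Rightarrow> bool" where
  "colouring k V B c \<longleftrightarrow>
     c ` V \<subseteq> {..<k} \<and> (\<forall>S\<in>B. \<not> (\<exists>i<k. verts S \<subseteq> colour_class V c i))"

definition colourable :: "nat \<Rightarrow> 'a set \<Rightarrow> 'a graph set \<Rightarrow> bool" where
  "colourable k V B \<longleftrightarrow> (\<exists>c. colouring k V B c)"

definition chromatic :: "nat \<Rightarrow> 'a set \<Rightarrow> 'a graph set \<Rightarrow> bool" where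
  "chromatic k V B \<longleftrightarrow> colourable k V B \<and> \<not> colourable (k - 1) V B"

definition uniquely_colourable :: "nat \<Rightarrow> 'a set \<Rightarrow> 'a graph set \<Rightarrow> bool" where
  "uniquely_colourable k V B \<longleftrightarrow>
     (\<forall>c d. colouring k V B c \<longrightarrow> colouring k V B d \<longrightarrow>
        (\<exists>p. p permutes {..<k} \<and> (\<forall>x\<in>V. d x = p (c x))))"

definition strongly_equitable :: "nat \<Rightarrow> 'a set \<Rightarrow> ('a \<Rightarrow> nat) \<Rightarrow> bool" where
  "strongly_equitable k V c \<longleftrightarrow>
     (\<forall>i<k. \<forall>j<k. card (colour_class V c i) = card (colour_class V c j))"

definition strongly_equitable_chromatic :: "nat \<Rightarrow> 'a set \<Rightarrow> 'a graph set \<Rightarrow> bool" where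
  "strongly_equitable_chromatic k V B \<longleftrightarrow>
     chromatic k V B \<and> (\<exists>c. colouring k V B c \<and> strongly_equitable k V c)"

definition strongly_equitable_uniquely_chromatic :: "nat \<Rightarrow> 'a set \<Rightarrow> 'a graph set \<Rightarrow> bool" where
  "strongly_equitable_uniquely_chromatic k V B \<longleftrightarrow>
     uniquely_colourable k V B \<and> chromatic k V B \<and>
     (\<exists>c. colouring k V B c \<and> strongly_equitable k V c)"

end

theory Submission
  imports Defs "HOL-Library.Disjoint_Sets" "HOL-Library.FuncSet" "HOL-Library.Nat_Bijection"
begin

text \<open>
  Arrange the vertices in a grid \<open>A \<times> {..<k}\<close> whose columns are the intended colour classes. Two
  properly coloured systems on disjoint sets of rows can be joined by letting every vertex choose its
  stars into the other part almost freely: any prescribed disjoint \<open>e\<close>-sets of leaves outside its own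
  column extend to a partition into leaf sets not inside its column, provided that they are
  not too many.

  A star whose \<open>e\<close> leaves all have colour \<open>q\<close> forbids \<open>q\<close> to its centre. Adding rows indexed by all
  conceivable colourings of the old part, and aiming the stars of each new row at the monochromatic
  sets of its index, one finds by pigeonhole, column after column, \<open>e\<close> equally coloured vertices of a
  colour not used for the earlier columns. After \<open>k\<close> steps some unknown row set is coloured
  according to a permutation of the columns; further rows aimed at all candidates for it are
  then coloured in this way for every colouring. Two such systems, joined so that their rows look at
  each other's forced rows, are forced everywhere.
\<close>

section \<open>Stars, monochromatic sets and colourings\<close>

definition mk_star :: "'a \<Rightarrow> 'a set \<Rightarrow> 'a graph" where
  "mk_star v L = (insert v L, {{v, x} | x. x \<in> L})"

lemma verts_mk_star [simp]: "verts (mk_star v L) = insert v L"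
  and edges_mk_star [simp]: "edges (mk_star v L) = {{v, x} | x. x \<in> L}"
  by (simp_all add: mk_star_def)

definition monochromatic :: "('a \<Rightarrow> nat) \<Rightarrow> 'a set \<Rightarrow> bool" where
  "monochromatic c X \<longleftrightarrow> (\<exists>i. \<forall>x\<in>X. c x = i)"

lemma star_system_verts_subset:
  assumes "star_system e n V B" "S \<in> B"
  shows "verts S \<subseteq> V" "verts S \<noteq> {}"
proof -
  have "is_star e S" "subgraph S (complete_graph V)"
    using assms unfolding star_system_def by blast+
  then show "verts S \<subseteq> V" "verts S \<noteq> {}"
    unfolding is_star_def subgraph_def complete_graph_def by auto
qed

lemma complete_graph_simps [simp]:
  "verts (complete_graph V) = V"
  "E \<in> edges (complete_graph V) \<longleftrightarrow> (\<exists>x\<in>V. \<exists>y\<in>V. x \<noteq> y \<and> E = {x, y})"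
  unfolding complete_graph_def by auto

lemma star_system_edge:
  assumes "star_system e n V B" "S \<in> B" "E \<in> edges S"
  shows "E \<subseteq> V" "E \<noteq> {}"
proof -
  have "E \<in> edges (complete_graph V)"
    using assms unfolding star_system_def subgraph_def by blast
  then show "E \<subseteq> V" "E \<noteq> {}" by auto
qed

lemma subgraph_complete_graph_mono:
  assumes "subgraph S (complete_graph V)" "V \<subseteq> V'"
  shows "subgraph S (complete_graph V')"
proof -
  have "edges (complete_graph V) \<subseteq> edges (complete_graph V')"
    using assms(2) by (auto simp: complete_graph_def)
  then show ?thesis using assms unfolding subgraph_def by auto
qed

text \<open>A star is nonempty and lies in \<open>V\<close>, so a common colour of its vertices is
  automatically below \<open>k\<close>. Hence monochromaticity can be treated without reference to
  \<open>k\<close> or to colour classes.\<close>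

lemma colouring_iff:
  assumes "star_system e n V B"
  shows "colouring k V B c \<longleftrightarrow> c ` V \<subseteq> {..<k} \<and> (\<forall>S\<in>B. \<not> monochromatic c (verts S))"
proof -
  have "(\<exists>i<k. verts S \<subseteq> colour_class V c i) \<longleftrightarrow> monochromatic c (verts S)"
    if "c ` V \<subseteq> {..<k}" "S \<in> B" for S
  proof
    assume "\<exists>i<k. verts S \<subseteq> colour_class V c i"
    then show "monochromatic c (verts S)" unfolding colour_class_def monochromatic_def by blast
  next
    assume "monochromatic c (verts S)"
    then obtain i where i: "\<forall>x\<in>verts S. c x = i" unfolding monochromatic_def by blast
    obtain x where "x \<in> verts S" "x \<in> V"
      using star_system_verts_subset[OF assms \<open>S \<in> B\<close>] by blast
    then have "i < k" using i that(1) by (metis image_subset_iff lessThan_iff)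
    moreover have "verts S \<subseteq> colour_class V c i"
      using i star_system_verts_subset(1)[OF assms \<open>S \<in> B\<close>] unfolding colour_class_def by auto
    ultimately show "\<exists>i<k. verts S \<subseteq> colour_class V c i" by blast
  qed
  then show ?thesis unfolding colouring_def by metis
qed

text \<open>Whatever is forced in every colouring of a part stays forced after the part has been
  joined to further rows.\<close>

lemma colouring_mono_system:
  assumes "star_system e n V B" "star_system e n' V' B'" "V \<subseteq> V'" "B \<subseteq> B'" "colouring k V' B' c"
  shows "colouring k V B c"
  using assms(3-5) unfolding colouring_iff[OF assms(1)] colouring_iff[OF assms(2)] by blast

section \<open>Transport of systems and colourings along an injection\<close>

definition map_graph :: "('a \<Rightarrow> 'b) \<Rightarrow> 'a graph \<Rightarrow> 'b graph" where
  "map_graph f G = (f ` verts G, image f ` edges G)"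

lemma verts_map_graph [simp]: "verts (map_graph f G) = f ` verts G"
  and edges_map_graph [simp]: "edges (map_graph f G) = image f ` edges G"
  by (simp_all add: map_graph_def)

lemma star_system_map:
  assumes "star_system e n V B" "inj_on f V"
  shows "star_system e n (f ` V) (map_graph f ` B)"
proof -
  note S = assms(1)[unfolded star_system_def]
  note edges_sub = star_system_edge(1)[OF assms(1)]
  have inj_edges: "E = E'"
    if "S \<in> B" "E \<in> edges S" "S' \<in> B" "E' \<in> edges S'" "f ` E = f ` E'" for S S' E E'
    using inj_on_image_eq_iff[OF assms(2)] edges_sub that by metis
  have map_complete: "image f ` edges (complete_graph V) = edges (complete_graph (f ` V))"
  proof (intro equalityI subsetI)
    fix E assume "E \<in> image f ` edges (complete_graph V)"
    then obtain x y where "x \<in> V" "y \<in> V" "x \<noteq> y" "E = {f x, f y}"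
      unfolding complete_graph_def by auto
    then show "E \<in> edges (complete_graph (f ` V))"
      using assms(2) unfolding complete_graph_def inj_on_def by auto
  next
    fix E assume "E \<in> edges (complete_graph (f ` V))"
    then obtain x y where *: "x \<in> V" "y \<in> V" "f x \<noteq> f y" "E = {f x, f y}"
      unfolding complete_graph_def by auto
    then have "{x, y} \<in> edges (complete_graph V)" "E = f ` {x, y}"
      unfolding complete_graph_def by auto
    then show "E \<in> image f ` edges (complete_graph V)" by blast
  qed
  have "is_star e (map_graph f S) \<and> subgraph (map_graph f S) (complete_graph (f ` V))"
    if "S \<in> B" for S
  proof
    from S that have star: "is_star e S" and sub: "subgraph S (complete_graph V)" by auto
    from star obtain v L where L: "finite L" "card L = e" "v \<notin> L"
      "S = (insert v L, {{v, x} | x. x \<in> L})" unfolding is_star_def by auto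
    with sub have V: "insert v L \<subseteq> V" unfolding subgraph_def complete_graph_def by simp
    have "card (f ` L) = e"
      using L(2) V assms(2) by (metis card_image inj_on_subset insert_subset)
    moreover have "finite (f ` L)" "f v \<notin> f ` L"
      using L(1,3) V assms(2) by (auto simp: inj_on_def)
    moreover have "map_graph f S = (insert (f v) (f ` L), {{f v, x} | x. x \<in> f ` L})"
    proof -
      have "image f ` {{v, x} | x. x \<in> L} = (\<lambda>x. f ` {v, x}) ` L" by blast
      also have "\<dots> = {{f v, x} | x. x \<in> f ` L}" by auto
      finally show ?thesis using L(4) unfolding map_graph_def by simp
    qed
    ultimately show "is_star e (map_graph f S)" unfolding is_star_def by blast
    show "subgraph (map_graph f S) (complete_graph (f ` V))"
      using sub image_mono[of "edges S" "edges (complete_graph V)" "image f"]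
      unfolding subgraph_def map_complete by auto
  qed
  moreover have "pairwise (\<lambda>S T. disjnt (edges S) (edges T)) (map_graph f ` B)"
  proof -
    have "disjnt (edges (map_graph f S)) (edges (map_graph f T))"
      if "S \<in> B" "T \<in> B" "map_graph f S \<noteq> map_graph f T" for S T
    proof -
      have "disjnt (edges S) (edges T)" using S that unfolding pairwise_def by metis
      then show ?thesis using inj_edges[OF that(1) _ that(2)] unfolding disjnt_iff by auto
    qed
    then show ?thesis unfolding pairwise_def by blast
  qed
  moreover have "(\<Union>S\<in>map_graph f ` B. edges S) = edges (complete_graph (f ` V))"
  proof -
    have "(\<Union>S\<in>map_graph f ` B. edges S) = image f ` (\<Union>S\<in>B. edges S)" by auto
    then show ?thesis using S map_complete by argo
  qed
  ultimately show ?thesis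
    using S card_image[OF assms(2)] unfolding star_system_def by blast
qed

lemma colouring_map:
  assumes "star_system e n V B" "inj_on f V"
  shows "colouring k (f ` V) (map_graph f ` B) c \<longleftrightarrow> colouring k V B (c \<circ> f)"
  unfolding colouring_iff[OF assms(1)] colouring_iff[OF star_system_map[OF assms]] monochromatic_def
  by auto

section \<open>Partitions into leaf sets\<close>

text \<open>Each new block uses up as many elements of \<open>A\<close> as possible, so that the invariant
  \<open>card R \<le> e * card (R - A)\<close> survives.\<close>

lemma ex_partition_avoiding:
  assumes "finite R" "e dvd card R" "card R \<le> e * card (R - A)" "e \<ge> 1"
  shows "\<exists>Q. partition_on R Q \<and> (\<forall>L\<in>Q. card L = e \<and> \<not> L \<subseteq> A)"
  using assms(1-3)
proof (induction "card R" arbitrary: R rule: less_induct)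
  case less
  show ?case
  proof (cases "R = {}")
    case True
    then show ?thesis by (intro exI[of _ "{}"]) (auto simp: partition_on_def)
  next
    case False
    let ?a = "card (R \<inter> A)" and ?b = "card (R - A)"
    have ab: "card R = ?a + ?b"
      using less.prems(1) by (metis card_Int_Diff)
    have "card R > 0" using False less.prems(1) by (simp add: card_gt_0_iff)
    then have "e \<le> card R" using less.prems(2) by (simp add: dvd_imp_le)
    have "?b > 0" using less.prems(3) \<open>card R > 0\<close> by (cases "?b = 0") auto
    define s where "s = min (e - 1) ?a"
    have s: "s \<le> ?a" "s < e" "e - s \<le> ?b"
      using \<open>?b > 0\<close> \<open>e \<le> card R\<close> ab assms(4) by (auto simp: s_def)
    obtain X where X: "X \<subseteq> R \<inter> A" "card X = s"
      using s(1) by (meson obtain_subset_with_card_n)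
    obtain Y where Y: "Y \<subseteq> R - A" "card Y = e - s"
      using s(3) by (meson obtain_subset_with_card_n)
    have fin: "finite X" "finite Y"
      using X Y less.prems(1) by (meson finite_Diff finite_Int finite_subset)+
    define L where "L = X \<union> Y"
    have cardL: "card L = e"
      unfolding L_def using X Y fin s(2) by (subst card_Un_disjoint) auto
    have "L \<subseteq> R" using X Y by (auto simp: L_def)
    have "Y \<noteq> {}" using Y(2) s(2) by auto
    then have nA: "\<not> L \<subseteq> A" using Y by (auto simp: L_def)
    have cR: "card (R - L) = card R - e"
      using \<open>L \<subseteq> R\<close> fin cardL by (simp add: card_Diff_subset L_def)
    have RA: "(R - L) - A = (R - A) - Y" using X by (auto simp: L_def)
    have cRA: "card ((R - L) - A) = ?b - (e - s)"
      unfolding RA using Y fin by (simp add: card_Diff_subset)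
    \<comment> \<open>If the block takes \<open>e - 1\<close> elements of \<open>A\<close>, it costs
      a single element outside \<open>A\<close>, and both sides of the invariant drop by
      \<open>e\<close>. Otherwise the block exhausts \<open>A\<close>, and everything left lies
      outside \<open>A\<close>.\<close>
    have "card (R - L) \<le> e * card ((R - L) - A)"
    proof (cases "e - 1 \<le> ?a")
      case True
      then have "e - s = 1" using assms(4) by (simp add: s_def)
      then show ?thesis using less.prems(3) unfolding cR cRA by (simp add: algebra_simps)
    next
      case False
      then have "card (R - L) = card ((R - L) - A)"
        unfolding cR cRA using ab \<open>e \<le> card R\<close> by (auto simp: s_def)
      then show ?thesis using assms(4) by simp
    qed
    moreover have "card (R - L) < card R" using cR \<open>e \<le> card R\<close> assms(4) by linarith
    moreover have "e dvd card (R - L)" using cR less.prems(2) by (simp add: dvd_diff_nat)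
    ultimately obtain Q where Q: "partition_on (R - L) Q" "\<forall>L\<in>Q. card L = e \<and> \<not> L \<subseteq> A"
      using less.hyps[of "R - L"] less.prems(1) by auto
    have "L \<noteq> {}" using nA by auto
    have "\<Union>(insert L Q) = R" using Q(1) \<open>L \<subseteq> R\<close> by (auto simp: partition_on_def)
    moreover have "disjoint (insert L Q)"
      using Q(1) by (auto simp: partition_on_def disjoint_def)
    ultimately have "partition_on R (insert L Q)"
      using Q(1) \<open>L \<noteq> {}\<close> by (auto simp: partition_on_def)
    then show ?thesis using Q(2) cardL nA by (intro exI[of _ "insert L Q"]) auto
  qed
qed

text \<open>Once the prescribed blocks are removed, at least half of what remains lies outside
  \<open>A\<close>. Since \<open>e\<close> is at least 2, this is the invariant needed to partition
  the remainder.\<close>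

lemma ex_partition_extending:
  assumes "finite R" "e dvd card R" "e \<ge> 2"
    and F: "disjoint F" "\<And>L. L \<in> F \<Longrightarrow> L \<subseteq> R - A \<and> card L = e"
    and le: "card (R \<inter> A) \<le> card (R - A - \<Union>F)"
  shows "\<exists>Q. partition_on R Q \<and> F \<subseteq> Q \<and> (\<forall>L\<in>Q. card L = e \<and> \<not> L \<subseteq> A)"
proof -
  let ?R = "R - \<Union>F"
  have "F \<subseteq> Pow R" using F(2) by auto
  then have "finite F" using assms(1) by (meson finite_Pow_iff finite_subset)
  have finL: "finite L" if "L \<in> F" for L using F(2)[OF that] assms(1) by (meson finite_Diff finite_subset)
  have FR: "\<Union>F \<subseteq> R" using F(2) by auto
  have "card (\<Union>F) = sum card F"
    using finL F(1) by (intro card_Union_disjoint) (auto simp: disjoint_def pairwise_def disjnt_def)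
  then have "card (\<Union>F) = card F * e" using F(2) by simp
  moreover have "card ?R = card R - card (\<Union>F)"
    using FR assms(1) by (meson card_Diff_subset finite_subset)
  ultimately have dvd: "e dvd card ?R" using assms(2) by (simp add: dvd_diff_nat)
  have RA: "?R - A = R - A - \<Union>F" "?R \<inter> A = R \<inter> A" using F(2) by auto
  have "card ?R = card (?R \<inter> A) + card (?R - A)"
    using assms(1) by (metis card_Int_Diff finite_Diff)
  also have "\<dots> \<le> 2 * card (?R - A)" using le RA by simp
  also have "\<dots> \<le> e * card (?R - A)" using assms(3) by simp
  finally obtain Q where Q: "partition_on ?R Q" "\<forall>L\<in>Q. card L = e \<and> \<not> L \<subseteq> A"
    using ex_partition_avoiding[of ?R e A] dvd assms(1,3) by auto
  have "{} \<notin> F" using F(2)[of "{}"] assms(3) by auto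
  have "\<Union>(F \<union> Q) = R" using Q(1) FR by (auto simp: partition_on_def)
  moreover have "disjoint (F \<union> Q)"
    using Q(1) F(1) by (intro disjoint_union) (auto simp: partition_on_def)
  ultimately have "partition_on R (F \<union> Q)"
    using Q(1) \<open>{} \<notin> F\<close> by (auto simp: partition_on_def)
  moreover have "\<not> L \<subseteq> A" if "L \<in> F" for L
  proof -
    have "L \<noteq> {}" "L \<inter> A = {}" using F(2)[OF that] assms(3) by auto
    then show ?thesis by blast
  qed
  ultimately show ?thesis using F(2) Q(2) by (intro exI[of _ "F \<union> Q"]) blast
qed

section \<open>Joining two star systems\<close>

text \<open>The sets \<open>Out v\<close> orient the edges between \<open>V\<close> and
  \<open>W\<close> away from their future centres. Cutting each \<open>Out v\<close> into
  \<open>e\<close>-sets then turns the cross edges into stars, and any such orientation and any such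
  cutting will do.\<close>

lemma star_system_join:
  assumes V: "star_system e n V B" and W: "star_system e m W C" and VW: "V \<inter> W = {}"
    and part: "\<And>v. v \<in> V \<union> W \<Longrightarrow> partition_on (Out v) (P v)"
    and card: "\<And>v L. v \<in> V \<union> W \<Longrightarrow> L \<in> P v \<Longrightarrow> card L = e"
    and e: "e \<ge> 1"
    and OutV: "\<And>v. v \<in> V \<Longrightarrow> Out v \<subseteq> W" and OutW: "\<And>w. w \<in> W \<Longrightarrow> Out w \<subseteq> V"
    and orient: "\<And>v w. v \<in> V \<Longrightarrow> w \<in> W \<Longrightarrow> w \<in> Out v \<longleftrightarrow> v \<notin> Out w"
  shows "star_system e (n + m) (V \<union> W) (B \<union> C \<union> {mk_star v L | v L. v \<in> V \<union> W \<and> L \<in> P v})"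
proof -
  define X where "X = {mk_star v L | v L. v \<in> V \<union> W \<and> L \<in> P v}"
  note SV = V[unfolded star_system_def] and SW = W[unfolded star_system_def]
  have sub: "L \<subseteq> Out v" if "v \<in> V \<union> W" "L \<in> P v" for v L
    using part that unfolding partition_on_def by blast
  have cover: "\<exists>L\<in>P v. x \<in> L" if "v \<in> V \<union> W" "x \<in> Out v" for v x
    using part[OF that(1)] that(2) unfolding partition_on_def by blast
  have same: "L = L'" if "v \<in> V \<union> W" "L \<in> P v" "L' \<in> P v" "x \<in> L" "x \<in> L'" for v L L' x
    using part[OF that(1)] that unfolding partition_on_def disjoint_def by blast
  have "is_star e S \<and> subgraph S (complete_graph (V \<union> W))" if S: "S \<in> B \<union> C \<union> X" for S
  proof -
    consider "S \<in> B" | "S \<in> C" | v L where "v \<in> V \<union> W" "L \<in> P v" "S = mk_star v L"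
      using S unfolding X_def by blast
    then show ?thesis
    proof cases
      case 1
      then show ?thesis using SV subgraph_complete_graph_mono[of S V "V \<union> W"] by simp
    next
      case 2
      then show ?thesis using SW subgraph_complete_graph_mono[of S W "V \<union> W"] by simp
    next
      case 3
      have "v \<notin> L" "L \<subseteq> V \<union> W"
        using sub[OF 3(1,2)] 3(1) OutV OutW VW by blast+
      moreover have "finite L" using card[OF 3(1,2)] e card.infinite by fastforce
      ultimately show ?thesis
        using 3 card[OF 3(1,2)] unfolding is_star_def subgraph_def complete_graph_def mk_star_def by auto
    qed
  qed
  moreover have "pairwise (\<lambda>S T. disjnt (edges S) (edges T)) (B \<union> C \<union> X)"
  proof -
    note EB = star_system_edge[OF V] and EC = star_system_edge[OF W]
    have XE: "\<exists>v L x. v \<in> V \<union> W \<and> L \<in> P v \<and> S = mk_star v L \<and> E = {v, x} \<and> x \<in> L"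
      if SX: "S \<in> X" "E \<in> edges S" for S E
    proof -
      obtain v L where vL: "v \<in> V \<union> W" "L \<in> P v" "S = mk_star v L"
        using SX(1) unfolding X_def by blast
      moreover obtain x where "E = {v, x}" "x \<in> L" using SX(2) vL(3) by auto
      ultimately show ?thesis by blast
    qed
    have EX: "\<not> E \<subseteq> V" "\<not> E \<subseteq> W" if SX: "S \<in> X" "E \<in> edges S" for S E
    proof -
      obtain v L x where vL: "v \<in> V \<union> W" "L \<in> P v" "E = {v, x}" "x \<in> L"
        using XE[OF SX] by blast
      then have "x \<in> Out v" using sub by blast
      then have "v \<in> V \<and> x \<in> W \<or> v \<in> W \<and> x \<in> V" using vL(1) OutV OutW by blast
      then show "\<not> E \<subseteq> V" "\<not> E \<subseteq> W" using vL(3) VW by auto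
    qed
    have BC: "disjnt (edges S) (edges T)" if "S \<in> B" "T \<in> C" for S T
      using EB[OF that(1)] EC[OF that(2)] VW unfolding disjnt_iff by (metis Int_greatest subset_empty)
    have BX: "disjnt (edges S) (edges T)" if "S \<in> B" "T \<in> X" for S T
      using EB[OF that(1)] EX[OF that(2)] unfolding disjnt_iff by metis
    have CX: "disjnt (edges S) (edges T)" if "S \<in> C" "T \<in> X" for S T
      using EC[OF that(1)] EX[OF that(2)] unfolding disjnt_iff by metis
    have XX: "S = T" if ST: "S \<in> X" "T \<in> X" "E \<in> edges S" "E \<in> edges T" for S T E
    proof -
      obtain v L x where 1: "v \<in> V \<union> W" "L \<in> P v" "S = mk_star v L" "E = {v, x}" "x \<in> L"
        using XE[OF ST(1,3)] by blast
      obtain v' L' x' where 2: "v' \<in> V \<union> W" "L' \<in> P v'" "T = mk_star v' L'" "E = {v', x'}" "x' \<in> L'"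
        using XE[OF ST(2,4)] by blast
      have out: "x \<in> Out v" "x' \<in> Out v'" using 1 2 sub by blast+
      \<comment> \<open>Otherwise the edge would be oriented both ways. So a cross edge determines
        its centre, and then the partition determines its leaf set.\<close>
      have "\<not> (v = x' \<and> x = v')"
        using out 1(1) 2(1) OutV OutW orient by (metis UnE subsetD)
      then have "v = v'" "x = x'" using 1(4) 2(4) by (auto simp: doubleton_eq_iff)
      then show ?thesis using 1 2 same by blast
    qed
    have "disjnt (edges S) (edges T)" if "S \<in> B \<union> C \<union> X" "T \<in> B \<union> C \<union> X" "S \<noteq> T" for S T
    proof -
      have "disjnt (edges S) (edges T)" if "S \<in> B" "T \<in> B" "S \<noteq> T" for S T
        using SV that unfolding pairwise_def by metis
      moreover have "disjnt (edges S) (edges T)" if "S \<in> C" "T \<in> C" "S \<noteq> T" for S T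
        using SW that unfolding pairwise_def by metis
      moreover have "disjnt (edges S) (edges T)" if "S \<in> X" "T \<in> X" "S \<noteq> T" for S T
        using XX[OF that(1,2)] that(3) unfolding disjnt_iff by blast
      ultimately show ?thesis
        using that BC BX CX disjnt_sym by (metis UnE)
    qed
    then show ?thesis unfolding pairwise_def by blast
  qed
  moreover have "(\<Union>S\<in>B \<union> C \<union> X. edges S) = edges (complete_graph (V \<union> W))"
  proof (intro equalityI subsetI)
    fix E assume "E \<in> (\<Union>S\<in>B \<union> C \<union> X. edges S)"
    then show "E \<in> edges (complete_graph (V \<union> W))"
      using calculation(1) unfolding subgraph_def by blast
  next
    fix E assume "E \<in> edges (complete_graph (V \<union> W))"
    then obtain x y where xy: "x \<in> V \<union> W" "y \<in> V \<union> W" "x \<noteq> y" "E = {x, y}"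
      unfolding complete_graph_def by auto
    have cross: "{v, w} \<in> (\<Union>S\<in>X. edges S)" if "v \<in> V" "w \<in> W" for v w
    proof -
      have out: "{a, b} \<in> (\<Union>S\<in>X. edges S)" if ab: "a \<in> V \<union> W" "b \<in> Out a" for a b
      proof -
        obtain L where "L \<in> P a" "b \<in> L" using cover[OF ab] by blast
        then have "mk_star a L \<in> X" "{a, b} \<in> edges (mk_star a L)"
          using ab(1) unfolding X_def by auto
        then show ?thesis by blast
      qed
      show ?thesis
        using out[of v w] out[of w v] orient[OF that] that unfolding insert_commute[of v w] by blast
    qed
    have "E \<in> (\<Union>S\<in>B. edges S)" if "x \<in> V" "y \<in> V"
    proof -
      have "E \<in> edges (complete_graph V)" using that xy by auto
      then show ?thesis using SV by argo
    qed
    moreover have "E \<in> (\<Union>S\<in>C. edges S)" if "x \<in> W" "y \<in> W"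
    proof -
      have "E \<in> edges (complete_graph W)" using that xy by auto
      then show ?thesis using SW by argo
    qed
    moreover have "E \<in> (\<Union>S\<in>X. edges S)" if "x \<in> V \<and> y \<in> W \<or> x \<in> W \<and> y \<in> V"
      using that cross[of x y] cross[of y x] unfolding xy(4) by (auto simp: insert_commute)
    moreover have "(\<Union>S\<in>B \<union> C \<union> X. edges S) =
        (\<Union>S\<in>B. edges S) \<union> (\<Union>S\<in>C. edges S) \<union> (\<Union>S\<in>X. edges S)" by blast
    ultimately show "E \<in> (\<Union>S\<in>B \<union> C \<union> X. edges S)" using xy(1,2) by (metis UnE UnI1 UnI2)
  qed
  ultimately show ?thesis
    using SV SW card_Un_disjoint[of V W, OF _ _ VW]
    unfolding star_system_def X_def[symmetric] by blast
qed

lemma colouring_star_neq: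
  assumes "star_system e n V B" "colouring k V B c" "mk_star v L \<in> B" "\<And>x. x \<in> L \<Longrightarrow> c x = q"
  shows "c v \<noteq> q"
proof
  assume "c v = q"
  then have "monochromatic c (verts (mk_star v L))"
    using assms(4) unfolding monochromatic_def by auto
  then show False using assms(2,3) colouring_iff[OF assms(1)] by blast
qed

lemma colouring_cong:
  assumes "star_system e n V B" "\<And>x. x \<in> V \<Longrightarrow> c x = d x"
  shows "colouring k V B c \<longleftrightarrow> colouring k V B d"
proof -
  have "monochromatic c (verts S) \<longleftrightarrow> monochromatic d (verts S)" if "S \<in> B" for S
    using star_system_verts_subset(1)[OF assms(1) that] assms(2) unfolding monochromatic_def
    by (metis subsetD)
  moreover have "c ` V = d ` V" using assms(2) by (rule image_cong[OF refl])
  ultimately show ?thesis unfolding colouring_iff[OF assms(1)] by auto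
qed

section \<open>Grid systems and their joins\<close>

text \<open>The columns are the classes of the colouring \<open>snd\<close> and all have
  \<open>card A\<close> vertices, so equitability comes for free. Divisibility by
  \<open>2 * e\<close> keeps the order in the required residue class and lets the vertices of all
  rows be cut into leaf sets.\<close>

definition grid_system :: "nat \<Rightarrow> nat \<Rightarrow> nat set \<Rightarrow> (nat \<times> nat) graph set \<Rightarrow> bool" where
  "grid_system k e A B \<longleftrightarrow> finite A \<and> 2 * e dvd card A * k \<and>
     star_system e (card A * k) (A \<times> {..<k}) B \<and> colouring k (A \<times> {..<k}) B snd"

lemma grid_systemD:
  assumes "grid_system k e A B"
  shows "finite A" "2 * e dvd card A * k" "star_system e (card A * k) (A \<times> {..<k}) B"
    "colouring k (A \<times> {..<k}) B snd"
  using assms unfolding grid_system_def by auto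

lemma grid_system_colouring_less:
  assumes "colouring k (A \<times> {..<k}) B c" "a \<in> A" "i < k"
  shows "c (a, i) < k"
  using assms unfolding colouring_def by (auto simp: image_subset_iff)

text \<open>Row \<open>a\<close> takes its leaves from the rows \<open>R a\<close>, and
  \<open>F a i\<close> are the leaf sets prescribed to the vertex \<open>(a, i)\<close>. They use at
  most half of the vertices outside column \<open>i\<close>. As \<open>k - 1\<close> is at least 2,
  at least \<open>card (R a)\<close> such vertices are left, enough to balance those in column
  \<open>i\<close> itself.\<close>

lemma grid_system_join:
  assumes "k \<ge> 3" "e \<ge> 2"
    and A: "grid_system k e A B" and A': "grid_system k e A' B'" and disj: "A \<inter> A' = {}"
    and RA: "\<And>a. a \<in> A \<Longrightarrow> R a \<subseteq> A'" and RA': "\<And>a. a \<in> A' \<Longrightarrow> R a \<subseteq> A"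
    and orient: "\<And>a a'. a \<in> A \<Longrightarrow> a' \<in> A' \<Longrightarrow> a' \<in> R a \<longleftrightarrow> a \<notin> R a'"
    and dvd: "\<And>a. a \<in> A \<union> A' \<Longrightarrow> e dvd card (R a) * k"
    and F_disj: "\<And>a i. a \<in> A \<union> A' \<Longrightarrow> i < k \<Longrightarrow> disjoint (F a i)"
    and F_sub: "\<And>a i L. a \<in> A \<union> A' \<Longrightarrow> i < k \<Longrightarrow> L \<in> F a i \<Longrightarrow> L \<subseteq> R a \<times> ({..<k} - {i}) \<and> card L = e"
    and F_card: "\<And>a i. a \<in> A \<union> A' \<Longrightarrow> i < k \<Longrightarrow> 2 * card (\<Union>(F a i)) \<le> card (R a) * (k - 1)"
  shows "\<exists>D. grid_system k e (A \<union> A') D \<and> B \<subseteq> D \<and> B' \<subseteq> D \<and>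
           (\<forall>a\<in>A \<union> A'. \<forall>i<k. \<forall>L\<in>F a i. mk_star (a, i) L \<in> D)"
proof -
  let ?K = "{..<k}"
  note dA = grid_systemD[OF A] and dA' = grid_systemD[OF A']
  have finR: "finite (R a)" if "a \<in> A \<union> A'" for a
    using that RA RA' dA(1) dA'(1) by (metis Un_iff finite_subset)
  \<comment> \<open>The set to be avoided is the column of the centre: a leaf set not inside it
    gives a star with two colours under \<open>snd\<close>.\<close>
  have "\<exists>Q. partition_on (R a \<times> ?K) Q \<and> F a i \<subseteq> Q \<and> (\<forall>L\<in>Q. card L = e \<and> \<not> L \<subseteq> UNIV \<times> {i})"
    if ai: "a \<in> A \<union> A'" "i < k" for a i
  proof (rule ex_partition_extending)
    have eqs: "R a \<times> ?K - UNIV \<times> {i} = R a \<times> (?K - {i})" "R a \<times> ?K \<inter> UNIV \<times> {i} = R a \<times> {i}"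
      using ai(2) by auto
    show "finite (R a \<times> ?K)" using finR[OF ai(1)] by simp
    show "e dvd card (R a \<times> ?K)" using dvd[OF ai(1)] by (simp add: card_cartesian_product)
    show "e \<ge> 2" by fact
    show "disjoint (F a i)" using F_disj ai by blast
    show "L \<subseteq> R a \<times> ?K - UNIV \<times> {i} \<and> card L = e" if "L \<in> F a i" for L
      using F_sub[OF ai that] unfolding eqs .
    have "\<Union>(F a i) \<subseteq> R a \<times> (?K - {i})" using F_sub[OF ai] by blast
    moreover have "finite (R a \<times> (?K - {i}))" using finR[OF ai(1)] by simp
    ultimately have "card (R a \<times> (?K - {i}) - \<Union>(F a i)) = card (R a \<times> (?K - {i})) - card (\<Union>(F a i))"
      by (meson card_Diff_subset finite_subset)
    also have "\<dots> = card (R a) * (k - 1) - card (\<Union>(F a i))"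
      using ai(2) by (simp add: card_cartesian_product)
    also have "\<dots> \<ge> card (R a)"
    proof -
      have "card (R a) * 2 \<le> card (R a) * (k - 1)" using assms(1) by (intro mult_le_mono) auto
      then show ?thesis using F_card[OF ai] by linarith
    qed
    finally show "card (R a \<times> ?K \<inter> UNIV \<times> {i}) \<le> card (R a \<times> ?K - UNIV \<times> {i} - \<Union>(F a i))"
      unfolding eqs by (simp add: card_cartesian_product)
  qed
  then obtain P where P: "\<And>a i. a \<in> A \<union> A' \<Longrightarrow> i < k \<Longrightarrow> partition_on (R a \<times> ?K) (P a i) \<and>
      F a i \<subseteq> P a i \<and> (\<forall>L\<in>P a i. card L = e \<and> \<not> L \<subseteq> UNIV \<times> {i})"
    by metis
  define Out where "Out v = R (fst v) \<times> ?K" for v :: "nat \<times> nat"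
  define Pv where "Pv v = P (fst v) (snd v)" for v
  define D where "D = B \<union> B' \<union> {mk_star v L | v L. v \<in> A \<times> ?K \<union> A' \<times> ?K \<and> L \<in> Pv v}"
  have mem: "fst v \<in> A \<union> A'" "snd v < k" if "v \<in> A \<times> ?K \<union> A' \<times> ?K" for v
    using that by auto
  have un: "A \<times> ?K \<union> A' \<times> ?K = (A \<union> A') \<times> ?K" by auto
  have cardU: "card (A \<union> A') * k = card A * k + card A' * k"
    using dA(1) dA'(1) disj by (simp add: card_Un_disjoint algebra_simps)
  have sys: "star_system e (card A * k + card A' * k) (A \<times> ?K \<union> A' \<times> ?K) D"
    unfolding D_def
  proof (rule star_system_join[OF dA(3) dA'(3), where Out = Out])
    show "A \<times> ?K \<inter> A' \<times> ?K = {}" using disj by auto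
    show "partition_on (Out v) (Pv v)" if "v \<in> A \<times> ?K \<union> A' \<times> ?K" for v
      using P[OF mem[OF that]] unfolding Out_def Pv_def by simp
    show "card L = e" if "v \<in> A \<times> ?K \<union> A' \<times> ?K" "L \<in> Pv v" for v L
      using P[OF mem[OF that(1)]] that(2) unfolding Pv_def by simp
    show "e \<ge> 1" using assms(2) by simp
    show "Out v \<subseteq> A' \<times> ?K" if "v \<in> A \<times> ?K" for v using RA[of "fst v"] that unfolding Out_def by auto
    show "Out v \<subseteq> A \<times> ?K" if "v \<in> A' \<times> ?K" for v using RA'[of "fst v"] that unfolding Out_def by auto
    show "w \<in> Out v \<longleftrightarrow> v \<notin> Out w" if "v \<in> A \<times> ?K" "w \<in> A' \<times> ?K" for v w
      using orient[of "fst v" "fst w"] that unfolding Out_def by auto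
  qed
  have "\<not> monochromatic snd (verts S)" if "S \<in> D" for S
  proof -
    consider "S \<in> B" | "S \<in> B'" | v L where "v \<in> A \<times> ?K \<union> A' \<times> ?K" "L \<in> Pv v" "S = mk_star v L"
      using \<open>S \<in> D\<close> unfolding D_def by blast
    then show ?thesis
    proof cases
      case 1
      then show ?thesis using dA(4) colouring_iff[OF dA(3)] by blast
    next
      case 2
      then show ?thesis using dA'(4) colouring_iff[OF dA'(3)] by blast
    next
      case 3
      then have "\<not> L \<subseteq> UNIV \<times> {snd v}" using P[OF mem[OF 3(1)]] unfolding Pv_def by blast
      then obtain x where "x \<in> L" "snd x \<noteq> snd v" by (metis SigmaI UNIV_I prod.collapse singletonI subsetI)
      then show ?thesis using 3(3) unfolding monochromatic_def by auto
    qed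
  qed
  then have "colouring k ((A \<union> A') \<times> ?K) D snd"
    using colouring_iff[OF sys] unfolding un by auto
  then have "grid_system k e (A \<union> A') D"
    using sys dA dA' unfolding grid_system_def un cardU by simp
  moreover have "mk_star (a, i) L \<in> D" if "a \<in> A \<union> A'" "i < k" "L \<in> F a i" for a i L
  proof -
    have "L \<in> Pv (a, i)" using P[OF that(1,2)] that(3) unfolding Pv_def by auto
    moreover have "(a, i) \<in> A \<times> ?K \<union> A' \<times> ?K" using that by auto
    ultimately show ?thesis unfolding D_def by blast
  qed
  ultimately show ?thesis unfolding D_def by blast
qed

lemma grid_system_shift:
  assumes "grid_system k e A B"
  shows "\<exists>B'. grid_system k e ((\<lambda>a. a + s) ` A) B'"
proof -
  let ?f = "map_prod (\<lambda>a. a + s) id :: nat \<times> nat \<Rightarrow> nat \<times> nat"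
  note d = grid_systemD[OF assms]
  have inj: "inj_on ?f (A \<times> {..<k})" by (auto simp: inj_on_def)
  have img: "?f ` (A \<times> {..<k}) = (\<lambda>a. a + s) ` A \<times> {..<k}" by force
  have card: "card ((\<lambda>a. a + s) ` A) = card A" by (simp add: card_image)
  have "star_system e (card A * k) ((\<lambda>a. a + s) ` A \<times> {..<k}) (map_graph ?f ` B)"
    using star_system_map[OF d(3) inj] unfolding img .
  moreover have "colouring k ((\<lambda>a. a + s) ` A \<times> {..<k}) (map_graph ?f ` B) snd"
  proof -
    have "snd \<circ> ?f = snd" by (simp add: fun_eq_iff)
    then show ?thesis using colouring_map[OF d(3) inj, of k snd] d(4) unfolding img by simp
  qed
  ultimately show ?thesis using d(1,2) unfolding grid_system_def card by blast
qed

text \<open>By finiteness \<open>p\<close> is a permutation of the colours, so the only value it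
  does not take away from \<open>i\<close> is \<open>p i\<close>.\<close>

lemma inj_on_endo_avoiding:
  fixes p :: "nat \<Rightarrow> nat"
  assumes "inj_on p {..<k}" "p ` {..<k} \<subseteq> {..<k}" "x < k" "x \<notin> p ` ({..<k} - {i})"
  shows "x = p i"
proof -
  have "p ` {..<k} = {..<k}" using assms(1,2) by (simp add: endo_inj_surj)
  then obtain j where "j < k" "x = p j" using assms(3) by (metis imageE lessThan_iff)
  then show ?thesis using assms(4) by blast
qed

section \<open>Large grid systems on fresh rows\<close>

locale grid =
  fixes k e :: nat and A\<^sub>0 B\<^sub>0
  assumes k: "k \<ge> 3" and e: "e \<ge> 2" and base: "grid_system k e A\<^sub>0 B\<^sub>0" "A\<^sub>0 \<noteq> {}"
begin

abbreviation colg where "colg A \<equiv> colouring k (A \<times> {..<k})"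

lemma fresh_base:
  assumes "finite X"
  shows "\<exists>A B. grid_system k e A B \<and> A \<inter> X = {} \<and> 1 \<le> card A"
proof -
  obtain s where s: "\<And>x. x \<in> X \<Longrightarrow> x < s"
    using assms finite_nat_set_iff_bounded by auto
  obtain B where "grid_system k e ((\<lambda>a. a + s) ` A\<^sub>0) B" using grid_system_shift[OF base(1)] by blast
  moreover have "((\<lambda>a. a + s) ` A\<^sub>0) \<inter> X = {}" using s by fastforce
  moreover have "1 \<le> card ((\<lambda>a. a + s) ` A\<^sub>0)"
    using base(2) grid_systemD(1)[OF base(1)] by (simp add: Suc_le_eq card_gt_0_iff)
  ultimately show ?thesis by blast
qed

text \<open>Shifted copies of the base system are joined one after another. All cross edges get
  their centres in the older rows, and no leaf sets are prescribed.\<close>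

lemma fresh_large:
  assumes "finite X"
  shows "\<exists>A B. grid_system k e A B \<and> A \<inter> X = {} \<and> N \<le> card A"
proof (induction N)
  case 0
  then show ?case using fresh_base[OF assms] by blast
next
  case (Suc N)
  then obtain A B where A: "grid_system k e A B" "A \<inter> X = {}" "N \<le> card A" by blast
  note dA = grid_systemD[OF A(1)]
  obtain A' B' where A': "grid_system k e A' B'" "A' \<inter> (X \<union> A) = {}" "1 \<le> card A'"
    using fresh_base[of "X \<union> A"] assms dA(1) by blast
  note dA' = grid_systemD[OF A'(1)]
  have "\<exists>D. grid_system k e (A \<union> A') D \<and> B \<subseteq> D \<and> B' \<subseteq> D \<and>
      (\<forall>a\<in>A \<union> A'. \<forall>i<k. \<forall>L\<in>{}. mk_star (a, i) L \<in> D)"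
    by (rule grid_system_join[OF k e A(1) A'(1), where R = "\<lambda>a. if a \<in> A then A' else {}"])
      (use A'(2) dA' in \<open>auto dest: dvd_mult_right dvd_mult_left\<close>)
  moreover have "card (A \<union> A') = card A + card A'"
    using dA(1) dA'(1) A'(2) by (intro card_Un_disjoint) auto
  ultimately show ?case using A(2,3) A'(2,3) by (intro exI[of _ "A \<union> A'"]) auto
qed

section \<open>Anchoring the columns one by one\<close>

text \<open>A star with leaves \<open>G i \<times> {i}\<close> forbids the colour \<open>p i\<close> to its centre.\<close>

definition anchored :: "nat set \<Rightarrow> (nat \<times> nat \<Rightarrow> nat) \<Rightarrow> nat \<Rightarrow> (nat \<Rightarrow> nat) \<Rightarrow> (nat \<Rightarrow> nat set) \<Rightarrow> bool" where
  "anchored A c t p G \<longleftrightarrow> inj_on p {..<t} \<and> p ` {..<t} \<subseteq> {..<k} \<and>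
     (\<forall>i<t. G i \<subseteq> A \<and> card (G i) = e \<and> (\<forall>a\<in>G i. c (a, i) = p i))"

text \<open>The new rows are indexed by all conceivable colourings of the old system; the rows whose
  index is the actual colouring have stars onto its anchors.\<close>

lemma anchored_extend:
  assumes A: "grid_system k e A B" and AX: "A \<inter> X = {}" "finite X" and large: "2 * e \<le> card A" and "t \<le> k"
    and anch: "\<forall>c. colg A B c \<longrightarrow> (\<exists>p G. anchored A c t p G)"
  shows "\<exists>A' D \<F>. grid_system k e A' D \<and> A \<subseteq> A' \<and> A' \<inter> X = {} \<and> disjoint \<F> \<and>
     (\<forall>H\<in>\<F>. H \<subseteq> A' \<and> card H = N) \<and> 2 * card (\<Union>\<F>) \<le> card A' \<and>
     (\<forall>c. colg A' D c \<longrightarrow> (\<exists>p G. anchored A c t p G \<and>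
        (\<exists>H\<in>\<F>. \<forall>a\<in>H. \<forall>i<k. c (a, i) \<notin> p ` ({..<t} - {i}))))"
proof -
  let ?K = "{..<k}"
  \<comment> \<open>Extensional functions make the index set finite, while it still contains the
    restriction of every colouring of a larger system.\<close>
  define \<Phi> where "\<Phi> = (A \<times> ?K) \<rightarrow>\<^sub>E ?K"
  note dA = grid_systemD[OF A]
  have "finite \<Phi>" unfolding \<Phi>_def using dA(1) by (intro finite_PiE) auto
  \<comment> \<open>There is room for \<open>N\<close> rows per index. The factor 2 keeps these rows
    within half of all rows, as is required when later centres are aimed at all of them.\<close>
  obtain A2 B2 where A2: "grid_system k e A2 B2" "A2 \<inter> (X \<union> A) = {}" "2 * (card \<Phi> * N) \<le> card A2"
    using fresh_large[of "X \<union> A"] AX(2) dA(1) by (meson finite_UnI)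
  note dA2 = grid_systemD[OF A2(1)]
  have "card (\<Phi> \<times> {..<N}) \<le> card A2" using A2(3) by (simp add: card_cartesian_product)
  then obtain h where h: "h ` (\<Phi> \<times> {..<N}) \<subseteq> A2" "inj_on h (\<Phi> \<times> {..<N})"
    using card_le_inj[of "\<Phi> \<times> {..<N}" A2] \<open>finite \<Phi>\<close> dA2(1) by auto
  \<comment> \<open>\<open>g\<close> reads off the index of a row. On rows outside the range of
    \<open>h\<close> it has some unspecified value; if that value is a colouring, such a row is
    given stars onto its anchors too.\<close>
  define g where "g a = fst (inv_into (\<Phi> \<times> {..<N}) h a)" for a
  have g: "g (h (f, r)) = f" if "f \<in> \<Phi>" "r < N" for f r
    unfolding g_def using inv_into_f_f[OF h(2), of "(f, r)"] that by simp
  obtain p G where pG: "\<And>c. colg A B c \<Longrightarrow> anchored A c t (p c) (G c)" using anch by metis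
  define R where "R a = (if a \<in> A2 then A else {})" for a
  \<comment> \<open>Column \<open>i\<close> is left out because a star from \<open>(a, i)\<close>
    onto the anchor in its own column would be monochromatic under \<open>snd\<close>.\<close>
  define F where "F a i = (if a \<in> A2 \<and> colg A B (g a)
      then (\<lambda>j. G (g a) j \<times> {j}) ` ({..<t} - {i}) else {})" for a i
  have "\<exists>D. grid_system k e (A \<union> A2) D \<and> B \<subseteq> D \<and> B2 \<subseteq> D \<and>
      (\<forall>a\<in>A \<union> A2. \<forall>i<k. \<forall>L\<in>F a i. mk_star (a, i) L \<in> D)"
  proof (rule grid_system_join[OF k e A A2(1), where R = R])
    show "A \<inter> A2 = {}" using A2(2) by auto
    then show "R a \<subseteq> A2" if "a \<in> A" for a using that by (auto simp: R_def)
    show "R a \<subseteq> A" if "a \<in> A2" for a using that by (auto simp: R_def)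
    show "a' \<in> R a \<longleftrightarrow> a \<notin> R a'" if "a \<in> A" "a' \<in> A2" for a a'
      using that A2(2) by (auto simp: R_def)
    show "e dvd card (R a) * k" for a using dA(2) by (auto simp: R_def dest: dvd_mult_right)
    show "disjoint (F a i)" for a i by (auto simp: F_def disjoint_def)
    show "L \<subseteq> R a \<times> (?K - {i}) \<and> card L = e" if L: "L \<in> F a i" for a i L
    proof -
      have a: "a \<in> A2" "colg A B (g a)" using L by (auto simp: F_def split: if_splits)
      then obtain j where j: "j < t" "j \<noteq> i" "L = G (g a) j \<times> {j}" using L by (auto simp: F_def)
      have "G (g a) j \<subseteq> A" "card (G (g a) j) = e"
        using pG[OF a(2)] j(1) unfolding anchored_def by auto
      then show ?thesis using j a(1) \<open>t \<le> k\<close> by (auto simp: R_def card_cartesian_product)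
    qed
    show "2 * card (\<Union>(F a i)) \<le> card (R a) * (k - 1)" if "i < k" for a i
    proof (cases "a \<in> A2 \<and> colg A B (g a)")
      case True
      then have G: "card (G (g a) j) = e" if "j < t" for j
        using pG[of "g a"] that unfolding anchored_def by auto
      have "card (\<Union>(F a i)) \<le> (\<Sum>j\<in>{..<t} - {i}. card (G (g a) j \<times> {j}))"
        unfolding F_def using True by (simp add: card_UN_le)
      also have "\<dots> = (\<Sum>j\<in>{..<t} - {i}. e)"
        using G by (intro sum.cong) (auto simp: card_cartesian_product)
      also have "\<dots> = card ({..<t} - {i}) * e" by simp
      also have "\<dots> \<le> (k - 1) * e"
      proof (intro mult_right_mono)
        have "card ({..<t} - {i}) \<le> card (?K - {i})" using \<open>t \<le> k\<close> by (intro card_mono) auto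
        then show "card ({..<t} - {i}) \<le> k - 1" using that by simp
      qed simp
      finally have "2 * card (\<Union>(F a i)) \<le> (2 * e) * (k - 1)" by (simp add: algebra_simps)
      also have "\<dots> \<le> card A * (k - 1)" using large by (intro mult_right_mono) auto
      finally show ?thesis using True by (simp add: R_def)
    next
      case False
      then show ?thesis by (auto simp: F_def)
    qed
  qed
  then obtain D where D: "grid_system k e (A \<union> A2) D" "B \<subseteq> D"
    "\<And>a i L. a \<in> A \<union> A2 \<Longrightarrow> i < k \<Longrightarrow> L \<in> F a i \<Longrightarrow> mk_star (a, i) L \<in> D" by blast
  note dD = grid_systemD[OF D(1)]
  define \<F> where "\<F> = (\<lambda>f. h ` ({f} \<times> {..<N})) ` \<Phi>"
  have "disjoint \<F>"
  proof -
    have "h ` ({f} \<times> {..<N}) \<inter> h ` ({f'} \<times> {..<N}) = {}" if "f \<in> \<Phi>" "f' \<in> \<Phi>" "f \<noteq> f'" for f f'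
      using g that by auto metis
    then show ?thesis unfolding \<F>_def disjoint_def by (auto simp del: image_insert)
  qed
  moreover have "H \<subseteq> A \<union> A2 \<and> card H = N" if HF: "H \<in> \<F>" for H
  proof -
    obtain f where f: "f \<in> \<Phi>" "H = h ` ({f} \<times> {..<N})" using HF unfolding \<F>_def by blast
    then have "inj_on h ({f} \<times> {..<N})" using h(2) by (auto intro: inj_on_subset)
    then have "card H = N" unfolding f(2) by (simp add: card_image card_cartesian_product)
    then show ?thesis using h(1) f by auto
  qed
  moreover have "2 * card (\<Union>\<F>) \<le> card (A \<union> A2)"
  proof -
    have "\<Union>\<F> = h ` (\<Phi> \<times> {..<N})" unfolding \<F>_def by auto
    then have "card (\<Union>\<F>) = card \<Phi> * N" using h(2) by (simp add: card_image card_cartesian_product)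
    moreover have "card A2 \<le> card (A \<union> A2)" using dD(1) by (intro card_mono) auto
    ultimately show ?thesis using A2(3) by simp
  qed
  moreover have "\<exists>p G. anchored A c t p G \<and> (\<exists>H\<in>\<F>. \<forall>a\<in>H. \<forall>i<k. c (a, i) \<notin> p ` ({..<t} - {i}))"
    if c: "colg (A \<union> A2) D c" for c
  proof -
    \<comment> \<open>The anchors were chosen for the index \<open>f\<close>, not for
      \<open>c\<close>. They serve for \<open>c\<close> as well, since the two agree on the old
      rows.\<close>
    define f where "f = restrict c (A \<times> ?K)"
    have cA: "colg A B c" using colouring_mono_system[OF dA(3) dD(3) _ D(2) c] by blast
    then have colf: "colg A B f" using colouring_cong[OF dA(3), of c f] by (simp add: f_def)
    have "f \<in> \<Phi>"
      unfolding \<Phi>_def f_def using grid_system_colouring_less[OF cA] by auto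
    have anch_c: "anchored A c t (p f) (G f)"
    proof -
      have "f (a, i) = c (a, i)" if "i < t" "a \<in> A" for a i using that \<open>t \<le> k\<close> by (simp add: f_def)
      then show ?thesis using pG[OF colf] unfolding anchored_def by (metis subsetD)
    qed
    have "c (a, i) \<notin> p f ` ({..<t} - {i})" if a: "a \<in> h ` ({f} \<times> {..<N})" and i: "i < k" for a i
    proof
      assume "c (a, i) \<in> p f ` ({..<t} - {i})"
      then obtain j where j: "j < t" "j \<noteq> i" "c (a, i) = p f j" by auto
      have aA: "a \<in> A2" using a h(1) \<open>f \<in> \<Phi>\<close> by auto
      moreover have "g a = f" using a g \<open>f \<in> \<Phi>\<close> by auto
      ultimately have "G f j \<times> {j} \<in> F a i" using colf j unfolding F_def by auto
      then have "mk_star (a, i) (G f j \<times> {j}) \<in> D" using D(3) aA i by blast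
      moreover have "c x = p f j" if "x \<in> G f j \<times> {j}" for x
        using that anch_c j(1) unfolding anchored_def by auto
      ultimately have "c (a, i) \<noteq> p f j" using colouring_star_neq[OF dD(3) c] by blast
      then show False using j(3) by simp
    qed
    moreover have "h ` ({f} \<times> {..<N}) \<in> \<F>" unfolding \<F>_def using \<open>f \<in> \<Phi>\<close> by blast
    ultimately show ?thesis using anch_c by blast
  qed
  moreover have "(A \<union> A2) \<inter> X = {}" using AX A2(2) by auto
  ultimately show ?thesis using D(1) by (intro exI[of _ "A \<union> A2"] exI[of _ D] exI[of _ \<F>]) auto
qed

text \<open>Induction on the number of anchored columns. Among \<open>k * e\<close> rows that see
  the present anchors, some colour occurs \<open>e\<close> times in column \<open>t\<close>; these
  rows form the next anchor, and its colour is new.\<close>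

lemma ex_anchored:
  assumes "finite X" "t \<le> k"
  shows "\<exists>A B. grid_system k e A B \<and> A \<inter> X = {} \<and> 2 * e \<le> card A \<and>
     (\<forall>c. colg A B c \<longrightarrow> (\<exists>p G. anchored A c t p G))"
  using assms(2)
proof (induction t)
  case 0
  then show ?case using fresh_large[OF assms(1), of "2 * e"] by (auto simp: anchored_def)
next
  case (Suc t)
  then obtain A B where A: "grid_system k e A B" "A \<inter> X = {}" "2 * e \<le> card A"
    "\<forall>c. colg A B c \<longrightarrow> (\<exists>p G. anchored A c t p G)" by auto
  have "t \<le> k" using Suc.prems by simp
  from anchored_extend[OF A(1,2) assms(1) A(3) this A(4), where N = "k * e"]
  obtain A' D \<F> where D: "grid_system k e A' D" "A \<subseteq> A'" "A' \<inter> X = {}"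
    "\<forall>H\<in>\<F>. H \<subseteq> A' \<and> card H = k * e"
    "\<forall>c. colg A' D c \<longrightarrow> (\<exists>p G. anchored A c t p G \<and>
        (\<exists>H\<in>\<F>. \<forall>a\<in>H. \<forall>i<k. c (a, i) \<notin> p ` ({..<t} - {i})))"
    by blast
  note dD = grid_systemD[OF D(1)]
  have "\<exists>p G. anchored A' c (Suc t) p G" if c: "colg A' D c" for c
  proof -
    obtain p G H where pG: "anchored A c t p G" and H: "H \<in> \<F>"
      and Hc: "\<And>a i. a \<in> H \<Longrightarrow> i < k \<Longrightarrow> c (a, i) \<notin> p ` ({..<t} - {i})"
      using D(5) c by blast
    have HA: "H \<subseteq> A'" "card H = k * e" using D(4) H by auto
    have lt: "c (a, t) < k" if "a \<in> H" for a
      using grid_system_colouring_less[OF c] that HA(1) Suc.prems by auto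
    have "\<exists>q<k. e \<le> card {a \<in> H. c (a, t) = q}"
    proof (rule ccontr)
      assume "\<not> ?thesis"
      then have "card {a \<in> H. c (a, t) = q} \<le> e - 1" if "q < k" for q using that by force
      moreover have "H = (\<Union>q<k. {a \<in> H. c (a, t) = q})" using lt by auto
      then have "card H \<le> (\<Sum>q<k. card {a \<in> H. c (a, t) = q})"
        using card_UN_le[of "{..<k}" "\<lambda>q. {a \<in> H. c (a, t) = q}"] by simp
      ultimately have "card H \<le> (\<Sum>q<k. e - 1)" by (meson lessThan_iff order_trans sum_mono)
      also have "\<dots> = k * (e - 1)" by simp
      also have "\<dots> < k * e" using k e by simp
      finally show False using HA(2) by simp
    qed
    then obtain q G' where q: "q < k" "G' \<subseteq> {a \<in> H. c (a, t) = q}" "card G' = e"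
      by (meson obtain_subset_with_card_n)
    have "G' \<noteq> {}" using q(3) e by auto
    then obtain a where "a \<in> H" "c (a, t) = q" using q(2) by auto
    \<comment> \<open>In column \<open>t\<close> the omission of the own column is void, so
      \<open>q\<close> avoids the colours of all earlier anchors and \<open>p(t := q)\<close> stays
      injective.\<close>
    then have "q \<notin> p ` ({..<t} - {t})" using Hc Suc.prems by (metis Suc_le_lessD)
    then have "q \<notin> p ` {..<t}" by auto
    then have "anchored A' c (Suc t) (p(t := q)) (G(t := G'))"
      using pG q D(2) HA(1) unfolding anchored_def
      by (auto simp: lessThan_Suc less_Suc_eq inj_on_def subset_iff)
    then show ?thesis by blast
  qed
  moreover have "2 * e \<le> card A'" using A(3) D(2) dD(1) by (meson card_mono order_trans)
  ultimately show ?case using D by blast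
qed

section \<open>Rows that are coloured by a permutation of the columns\<close>

definition forced :: "nat set \<Rightarrow> (nat \<times> nat \<Rightarrow> nat) \<Rightarrow> (nat \<Rightarrow> nat) \<Rightarrow> bool" where
  "forced U c p \<longleftrightarrow> inj_on p {..<k} \<and> p ` {..<k} \<subseteq> {..<k} \<and> (\<forall>a\<in>U. \<forall>i<k. c (a, i) = p i)"

text \<open>The stars onto the forced rows, one for each column other than \<open>i\<close>, exclude
  every colour but \<open>p i\<close>.\<close>

lemma forced_by_stars:
  assumes "star_system e n (A \<times> {..<k}) D" "colg A D c" "forced U c p" "a \<in> A" "i < k" "H \<subseteq> U"
    and "\<And>j. j < k \<Longrightarrow> j \<noteq> i \<Longrightarrow> mk_star (a, i) (H \<times> {j}) \<in> D"
  shows "c (a, i) = p i"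
proof (rule inj_on_endo_avoiding[where p = p and i = i])
  show "inj_on p {..<k}" "p ` {..<k} \<subseteq> {..<k}" using assms(3) unfolding forced_def by auto
  show "c (a, i) < k" using grid_system_colouring_less[OF assms(2,4,5)] .
  show "c (a, i) \<notin> p ` ({..<k} - {i})"
  proof
    assume "c (a, i) \<in> p ` ({..<k} - {i})"
    then obtain j where j: "j < k" "j \<noteq> i" "c (a, i) = p j" by auto
    have "c x = p j" if "x \<in> H \<times> {j}" for x
      using that assms(3,6) j(1) unfolding forced_def by auto
    then show False
      using colouring_star_neq[OF assms(1,2) assms(7)[OF j(1,2)]] j(3) by blast
  qed
qed

text \<open>Verifies the conditions on prescribed leaf sets in \<open>grid_system_join\<close> when
  a vertex of column \<open>i\<close> is aimed at every candidate block in every other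
  column.\<close>

lemma row_blocks:
  assumes "disjoint \<F>" "finite R" "2 * card (\<Union>\<F>) \<le> card R" "\<And>H. H \<in> \<F> \<Longrightarrow> H \<subseteq> R \<and> card H = e" "i < k"
  defines "F \<equiv> {H \<times> {j} | H j. H \<in> \<F> \<and> j < k \<and> j \<noteq> i}"
  shows "disjoint F" "\<And>L. L \<in> F \<Longrightarrow> L \<subseteq> R \<times> ({..<k} - {i}) \<and> card L = e"
    "2 * card (\<Union>F) \<le> card R * (k - 1)"
proof -
  show "disjoint F"
  proof (rule disjointI)
    fix L L' assume "L \<in> F" "L' \<in> F" "L \<noteq> L'"
    then obtain H j H' j' where "H \<in> \<F>" "H' \<in> \<F>" "L = H \<times> {j}" "L' = H' \<times> {j'}" "H \<noteq> H' \<or> j \<noteq> j'"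
      unfolding F_def by blast
    moreover from this have "H \<inter> H' = {}" if "H \<noteq> H'" using assms(1) that unfolding disjoint_def by blast
    ultimately show "L \<inter> L' = {}" by auto
  qed
  show "L \<subseteq> R \<times> ({..<k} - {i}) \<and> card L = e" if L: "L \<in> F" for L
  proof -
    obtain H j where "H \<in> \<F>" "j < k" "j \<noteq> i" "L = H \<times> {j}" using L unfolding F_def by blast
    moreover from this have "H \<subseteq> R" "card H = e" using assms(4) by auto
    ultimately show ?thesis by (auto simp: card_cartesian_product)
  qed
  have "\<Union>\<F> \<subseteq> R" using assms(4) by blast
  then have fin: "finite (\<Union>\<F>)" using assms(2) finite_subset by blast
  have "\<Union>F \<subseteq> \<Union>\<F> \<times> ({..<k} - {i})" unfolding F_def by blast
  then have "card (\<Union>F) \<le> card (\<Union>\<F> \<times> ({..<k} - {i}))" using fin by (intro card_mono) auto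
  also have "\<dots> = card (\<Union>\<F>) * (k - 1)" using assms(5) by (simp add: card_cartesian_product)
  finally have "2 * card (\<Union>F) \<le> (2 * card (\<Union>\<F>)) * (k - 1)" by simp
  also have "\<dots> \<le> card R * (k - 1)" using assms(3) by (intro mult_right_mono) auto
  finally show "2 * card (\<Union>F) \<le> card R * (k - 1)" .
qed

text \<open>The block that is forced depends on the colouring, so the new rows \<open>U\<close> are
  aimed at all candidate blocks at once; the same \<open>U\<close> is then forced in every
  colouring. The size and divisibility of \<open>U\<close> allow it to serve as a set of leaf rows
  in a later join.\<close>

lemma ex_forced_rows:
  assumes "finite X"
  shows "\<exists>A B U. grid_system k e A B \<and> A \<inter> X = {} \<and> U \<subseteq> A \<and> 2 * e \<le> card U \<and> e dvd card U * k \<and>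
     (\<forall>c. colg A B c \<longrightarrow> (\<exists>p. forced U c p))"
proof -
  obtain A\<^sub>1 B\<^sub>1 where A1: "grid_system k e A\<^sub>1 B\<^sub>1" "A\<^sub>1 \<inter> X = {}" "2 * e \<le> card A\<^sub>1"
    "\<forall>c. colg A\<^sub>1 B\<^sub>1 c \<longrightarrow> (\<exists>p G. anchored A\<^sub>1 c k p G)"
    using ex_anchored[OF assms order_refl] by blast
  \<comment> \<open>All \<open>k\<close> columns are anchored here, and a block of \<open>e\<close>
    rows meets each column in exactly one leaf set.\<close>
  from anchored_extend[OF A1(1,2) assms A1(3) order_refl A1(4), where N = e]
  obtain A B \<F> where A: "grid_system k e A B" "A\<^sub>1 \<subseteq> A" "A \<inter> X = {}" "disjoint \<F>"
    "\<And>H. H \<in> \<F> \<Longrightarrow> H \<subseteq> A \<and> card H = e" "2 * card (\<Union>\<F>) \<le> card A"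
    "\<And>c. colg A B c \<Longrightarrow> \<exists>p G. anchored A\<^sub>1 c k p G \<and>
        (\<exists>H\<in>\<F>. \<forall>a\<in>H. \<forall>i<k. c (a, i) \<notin> p ` ({..<k} - {i}))"
    by auto
  note dA = grid_systemD[OF A(1)]
  have row: "\<exists>H\<in>\<F>. \<exists>p. forced H c p" if c: "colg A B c" for c
  proof -
    obtain p G H where pG: "anchored A\<^sub>1 c k p G" and H: "H \<in> \<F>"
      and Hc: "\<And>a i. a \<in> H \<Longrightarrow> i < k \<Longrightarrow> c (a, i) \<notin> p ` ({..<k} - {i})"
      using A(7)[OF c] by blast
    \<comment> \<open>With all columns anchored, the stars of \<open>(a, i)\<close> exclude the
      colours \<open>p j\<close> of all other columns, which leaves \<open>p i\<close>.\<close>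
    have "c (a, i) = p i" if "a \<in> H" "i < k" for a i
      using inj_on_endo_avoiding[OF _ _ _ Hc[OF that]] pG grid_system_colouring_less[OF c _ that(2)]
        A(5)[OF H] that(1) unfolding anchored_def by blast
    then have "forced H c p" using pG unfolding forced_def anchored_def by blast
    then show ?thesis using H by blast
  qed
  obtain U C where U: "grid_system k e U C" "U \<inter> (X \<union> A) = {}" "2 * e \<le> card U"
    using fresh_large[of "X \<union> A"] assms dA(1) by (meson finite_UnI)
  note dU = grid_systemD[OF U(1)]
  define R where "R a = (if a \<in> U then A else {})" for a
  define F where "F a i = (if a \<in> U then {H \<times> {j} | H j. H \<in> \<F> \<and> j < k \<and> j \<noteq> i} else {})" for a i
  note rb = row_blocks[OF A(4) dA(1) A(6) A(5)]
  have "\<exists>D. grid_system k e (A \<union> U) D \<and> B \<subseteq> D \<and> C \<subseteq> D \<and>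
      (\<forall>a\<in>A \<union> U. \<forall>i<k. \<forall>L\<in>F a i. mk_star (a, i) L \<in> D)"
  proof (rule grid_system_join[OF k e A(1) U(1), where R = R])
    show "A \<inter> U = {}" using U(2) by auto
    then show "R a \<subseteq> U" if "a \<in> A" for a using that by (auto simp: R_def)
    show "R a \<subseteq> A" if "a \<in> U" for a using that by (auto simp: R_def)
    show "a' \<in> R a \<longleftrightarrow> a \<notin> R a'" if "a \<in> A" "a' \<in> U" for a a'
      using that U(2) by (auto simp: R_def)
    show "e dvd card (R a) * k" for a using dA(2) by (auto simp: R_def dest: dvd_mult_right)
    show "disjoint (F a i)" if "i < k" for a i using rb(1)[OF _ that] by (simp add: F_def)
    show "L \<subseteq> R a \<times> ({..<k} - {i}) \<and> card L = e" if "i < k" "L \<in> F a i" for a i L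
    proof -
      have "a \<in> U" using that(2) by (auto simp: F_def split: if_splits)
      then show ?thesis using rb(2)[OF _ that(1), of L] that(2) by (simp add: F_def R_def)
    qed
    show "2 * card (\<Union>(F a i)) \<le> card (R a) * (k - 1)" if "i < k" for a i
      using rb(3)[OF _ that] by (simp add: F_def R_def)
  qed
  then obtain D where D: "grid_system k e (A \<union> U) D" "B \<subseteq> D"
    "\<And>a i L. a \<in> A \<union> U \<Longrightarrow> i < k \<Longrightarrow> L \<in> F a i \<Longrightarrow> mk_star (a, i) L \<in> D" by blast
  note dD = grid_systemD[OF D(1)]
  have "\<exists>p. forced U c p" if c: "colg (A \<union> U) D c" for c
  proof -
    have "colg A B c" using colouring_mono_system[OF dA(3) dD(3) _ D(2) c] by blast
    then obtain H p where H: "H \<in> \<F>" "forced H c p" using row by blast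
    have "c (a, i) = p i" if ai: "a \<in> U" "i < k" for a i
    proof (rule forced_by_stars[OF dD(3) c H(2) _ ai(2) order_refl])
      show "mk_star (a, i) (H \<times> {j}) \<in> D" if "j < k" "j \<noteq> i" for j
      proof -
        have "H \<times> {j} \<in> F a i" using H(1) ai(1) that unfolding F_def by auto
        then show ?thesis using D(3) ai by blast
      qed
    qed (use ai in auto)
    then show ?thesis using H(2) unfolding forced_def by blast
  qed
  moreover have "(A \<union> U) \<inter> X = {}" using A(3) U(2) by auto
  moreover have "e dvd card U * k" using dU(2) by (auto dest: dvd_mult_right)
  ultimately show ?thesis using D(1) U(3) by (intro exI[of _ "A \<union> U"] exI[of _ D] exI[of _ U]) auto
qed

text \<open>Two systems with forced rows \<open>U\<close> and \<open>U'\<close> are joined so that every vertex outside \<open>U'\<close> has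
  stars onto \<open>U\<close> or \<open>U'\<close>. Rows of \<open>U\<close> look at \<open>U'\<close>, which makes the two forcing maps agree.\<close>

lemma ex_forced_grid_system:
  "\<exists>A B. grid_system k e A B \<and> A \<noteq> {} \<and> (\<forall>c. colg A B c \<longrightarrow> (\<exists>p. forced A c p))"
proof -
  obtain A B U where A: "grid_system k e A B" "U \<subseteq> A" "2 * e \<le> card U" "e dvd card U * k"
    "\<And>c. colg A B c \<Longrightarrow> \<exists>p. forced U c p" using ex_forced_rows[of "{}"] by auto
  note dA = grid_systemD[OF A(1)]
  obtain A' B' U' where A': "grid_system k e A' B'" "A' \<inter> A = {}" "U' \<subseteq> A'" "2 * e \<le> card U'"
    "e dvd card U' * k" "\<And>c. colg A' B' c \<Longrightarrow> \<exists>p. forced U' c p"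
    using ex_forced_rows[OF dA(1)] by blast
  note dA' = grid_systemD[OF A'(1)]
  have fin: "finite U" "finite U'" using A(2) A'(3) dA(1) dA'(1) finite_subset by blast+
  obtain H where H: "H \<subseteq> U" "card H = e" using A(3) by (metis obtain_subset_with_card_n le_add1 mult_2 order_trans)
  obtain H' where H': "H' \<subseteq> U'" "card H' = e" using A'(4) by (metis obtain_subset_with_card_n le_add1 mult_2 order_trans)
  \<comment> \<open>Cross edges get their centres in \<open>A\<close>, except those between
    \<open>U\<close> and \<open>A' - U'\<close>, which get them in \<open>A' - U'\<close>. Thus
    every row of \<open>A\<close> sees \<open>U'\<close> and every row of \<open>A' - U'\<close>
    sees \<open>U\<close>.\<close>
  define R where "R a = (if a \<in> U then U' else if a \<in> A then A' else if a \<in> U' then {} else U)" for a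
  define G where "G a = (if a \<in> A then {H'} else if a \<in> U' then {} else {H})" for a
  define F where "F a i = {I \<times> {j} | I j. I \<in> G a \<and> j < k \<and> j \<noteq> i}" for a i
  have R_fin: "finite (R a)" for a using fin dA(1) dA'(1) by (simp add: R_def)
  have G_disj: "disjoint (G a)" for a by (simp add: G_def disjoint_def)
  have G_sub: "I \<subseteq> R a \<and> card I = e" if "I \<in> G a" for a I
    using that H H' A(2) A'(3) by (auto simp: G_def R_def split: if_splits)
  have G_card: "2 * card (\<Union>(G a)) \<le> card (R a)" for a
  proof -
    have "card U' \<le> card A'" using A'(3) dA'(1) by (simp add: card_mono)
    then show ?thesis using H(2) H'(2) A(2,3) A'(4) by (auto simp: G_def R_def)
  qed
  note rb = row_blocks[OF G_disj R_fin G_card G_sub]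
  have "\<exists>D. grid_system k e (A \<union> A') D \<and> B \<subseteq> D \<and> B' \<subseteq> D \<and>
      (\<forall>a\<in>A \<union> A'. \<forall>i<k. \<forall>L\<in>F a i. mk_star (a, i) L \<in> D)"
  proof (rule grid_system_join[OF k e A(1) A'(1), where R = R])
    show "A \<inter> A' = {}" using A'(2) by auto
    show "R a \<subseteq> A'" if "a \<in> A" for a using that A'(3) by (auto simp: R_def)
    show "R a \<subseteq> A" if "a \<in> A'" for a using that A(2) A'(2) by (auto simp: R_def)
    show "a' \<in> R a \<longleftrightarrow> a \<notin> R a'" if "a \<in> A" "a' \<in> A'" for a a'
    proof -
      have "a' \<notin> A" "a' \<notin> U" using that A(2) A'(2) by auto
      then show ?thesis using that by (auto simp: R_def)
    qed
    show "e dvd card (R a) * k" for a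
      using A(4) A'(5) dA'(2) by (auto simp: R_def dest: dvd_mult_right)
    show "disjoint (F a i)" if "i < k" for a i using rb(1)[OF _ that] by (simp add: F_def)
    show "L \<subseteq> R a \<times> ({..<k} - {i}) \<and> card L = e" if "i < k" "L \<in> F a i" for a i L
      using rb(2)[OF _ that(1)] that(2) unfolding F_def by blast
    show "2 * card (\<Union>(F a i)) \<le> card (R a) * (k - 1)" if "i < k" for a i
      using rb(3)[OF _ that] by (simp add: F_def)
  qed
  then obtain D where D: "grid_system k e (A \<union> A') D" "B \<subseteq> D" "B' \<subseteq> D"
    "\<And>a i L. a \<in> A \<union> A' \<Longrightarrow> i < k \<Longrightarrow> L \<in> F a i \<Longrightarrow> mk_star (a, i) L \<in> D" by blast
  note dD = grid_systemD[OF D(1)]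
  have star: "mk_star (a, i) (I \<times> {j}) \<in> D"
    if "a \<in> A \<union> A'" "i < k" "I \<in> G a" "j < k" "j \<noteq> i" for a i I j
    using D(4)[OF that(1,2)] that(3-5) unfolding F_def by blast
  have "\<exists>p. forced (A \<union> A') c p" if c: "colg (A \<union> A') D c" for c
  proof -
    \<comment> \<open>A single \<open>p\<close> spreads through the whole system: from
      \<open>U'\<close> to all of \<open>A\<close>, in particular to \<open>U\<close>, and from
      there to \<open>A' - U'\<close>.\<close>
    have "colg A' B' c" using colouring_mono_system[OF dA'(3) dD(3) _ D(3) c] by blast
    then obtain p where p: "forced U' c p" using A'(6) by blast
    have A_p: "c (a, i) = p i" if "a \<in> A" "i < k" for a i
      by (rule forced_by_stars[OF dD(3) c p _ that(2) H'(1)]) (use that star[of a i H'] in \<open>auto simp: G_def\<close>)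
    then have U: "forced U c p" using p A(2) unfolding forced_def by blast
    have "c (a, i) = p i" if "a \<in> A' - U'" "i < k" for a i
    proof (rule forced_by_stars[OF dD(3) c U _ that(2) H(1)])
      have "a \<notin> A" using that(1) A'(2) by blast
      then have "H \<in> G a" using that(1) by (simp add: G_def)
      then show "mk_star (a, i) (H \<times> {j}) \<in> D" if "j < k" "j \<noteq> i" for j
        using star \<open>i < k\<close> \<open>a \<in> A' - U'\<close> that by blast
    qed (use that in auto)
    then have "c (a, i) = p i" if "a \<in> A \<union> A'" "i < k" for a i
      using A_p p that unfolding forced_def by blast
    then show ?thesis using p unfolding forced_def by blast
  qed
  moreover have "A \<union> A' \<noteq> {}" using A(2,3) e by auto
  ultimately show ?thesis using D(1) by blast
qed

end

section \<open>Passing between grid systems and the original notions\<close>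

text \<open>Two colourings \<open>p \<circ> r\<close> and \<open>q \<circ> r\<close> differ by
  \<open>q\<close> after the inverse of \<open>p\<close>. A colouring with \<open>k - 1\<close>
  colours is impossible because \<open>p \<circ> r\<close> takes \<open>k\<close> values.\<close>

lemma strongly_equitable_uniquely_chromaticI:
  assumes sys: "star_system e n V B" and r: "colouring k V B r" "strongly_equitable k V r" "r ` V = {..<k}"
    and "k \<ge> 1"
    and forced: "\<And>c. colouring k V B c \<Longrightarrow>
      \<exists>p. inj_on p {..<k} \<and> p ` {..<k} \<subseteq> {..<k} \<and> (\<forall>x\<in>V. c x = p (r x))"
  shows "strongly_equitable_uniquely_chromatic k V B"
proof -
  have "\<exists>\<pi>. \<pi> permutes {..<k} \<and> (\<forall>x\<in>V. d x = \<pi> (c x))"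
    if c: "colouring k V B c" and d: "colouring k V B d" for c d
  proof -
    obtain p where p: "inj_on p {..<k}" "p ` {..<k} \<subseteq> {..<k}" "\<forall>x\<in>V. c x = p (r x)"
      using forced[OF c] by blast
    obtain q where q: "inj_on q {..<k}" "q ` {..<k} \<subseteq> {..<k}" "\<forall>x\<in>V. d x = q (r x)"
      using forced[OF d] by blast
    have bp: "bij_betw p {..<k} {..<k}" and bq: "bij_betw q {..<k} {..<k}"
      using p(1,2) q(1,2) by (simp_all add: bij_betw_def endo_inj_surj)
    \<comment> \<open>\<open>permutes\<close> demands the identity outside the colours.\<close>
    define \<pi> where "\<pi> x = (if x \<in> {..<k} then (q \<circ> inv_into {..<k} p) x else x)" for x
    have "bij_betw (q \<circ> inv_into {..<k} p) {..<k} {..<k}"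
      using bij_betw_trans[OF bij_betw_inv_into[OF bp] bq] .
    then have "bij_betw \<pi> {..<k} {..<k}" by (subst bij_betw_cong[where g = "q \<circ> inv_into {..<k} p"]) (auto simp: \<pi>_def)
    then have "\<pi> permutes {..<k}" by (intro bij_imp_permutes) (auto simp: \<pi>_def)
    moreover have "d x = \<pi> (c x)" if "x \<in> V" for x
    proof -
      have "r x \<in> {..<k}" using r(3) that by blast
      then have "inv_into {..<k} p (p (r x)) = r x" "p (r x) \<in> {..<k}"
        using p(1,2) by (auto simp: inv_into_f_f)
      then show ?thesis using p(3) q(3) that by (simp add: \<pi>_def)
    qed
    ultimately show ?thesis by blast
  qed
  moreover have "\<not> colourable (k - 1) V B"
  proof
    assume "colourable (k - 1) V B"
    then obtain c where c: "colouring (k - 1) V B c" unfolding colourable_def by blast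
    then have "c ` V \<subseteq> {..<k - 1}" using colouring_iff[OF sys] by blast
    moreover from this have "colouring k V B c"
      using c unfolding colouring_iff[OF sys] by (meson lessThan_subset_iff diff_le_self order_trans)
    then obtain p where p: "inj_on p {..<k}" "\<forall>x\<in>V. c x = p (r x)" using forced by blast
    then have "c ` V = p ` {..<k}" unfolding r(3)[symmetric] image_image by (intro image_cong) auto
    ultimately have "card (p ` {..<k}) \<le> card {..<k - 1}" by (intro card_mono) auto
    then show False using p(1) \<open>k \<ge> 1\<close> by (simp add: card_image)
  qed
  ultimately show ?thesis
    using r(1,2) unfolding strongly_equitable_uniquely_chromatic_def uniquely_colourable_def
      chromatic_def colourable_def by blast
qed

lemma grid_system_of_equitable:
  assumes sys: "star_system e n V B" and c: "colouring k V B c" "strongly_equitable k V c"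
    and "2 * e dvd n" "V \<noteq> {}" "k \<ge> 1"
  shows "\<exists>A D. grid_system k e A D \<and> A \<noteq> {}"
proof -
  have V: "finite V" "card V = n" using sys unfolding star_system_def by auto
  have c_less: "c x < k" if "x \<in> V" for x
    using c(1) that unfolding colouring_def by (auto simp: image_subset_iff)
  define m where "m = card (colour_class V c 0)"
  have "card (colour_class V c i) = m" if "i < k" for i
    using c(2) that \<open>k \<ge> 1\<close> unfolding strongly_equitable_def m_def by (metis less_eq_Suc_le One_nat_def)
  moreover have "finite (colour_class V c i)" for i using V(1) unfolding colour_class_def by simp
  ultimately have "\<exists>h. bij_betw h (colour_class V c i) {..<m}" if "i < k" for i
    using that by (metis bij_betw_iff_card card_lessThan finite_lessThan)
  then obtain h where h: "\<And>i. i < k \<Longrightarrow> bij_betw (h i) (colour_class V c i) {..<m}" by metis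
  \<comment> \<open>A vertex goes to its number within its colour class and its colour; the classes
    have the common size \<open>m\<close>, so they become the columns of a full grid.\<close>
  define f where "f x = (h (c x) x, c x)" for x
  have cls: "x \<in> colour_class V c (c x)" if "x \<in> V" for x using that unfolding colour_class_def by simp
  have inj: "inj_on f V"
  proof (rule inj_onI)
    fix x y assume xy: "x \<in> V" "y \<in> V" "f x = f y"
    then have "c x = c y" "h (c x) x = h (c x) y" unfolding f_def by auto
    then show "x = y"
      using h[OF c_less[OF xy(1)]] cls[OF xy(1)] cls[OF xy(2)] unfolding bij_betw_def inj_on_def by metis
  qed
  have img: "f ` V = {..<m} \<times> {..<k}"
  proof (intro equalityI subsetI)
    fix v assume "v \<in> f ` V"
    then obtain x where x: "x \<in> V" "v = f x" by blast
    have "h (c x) x \<in> {..<m}" using h[OF c_less[OF x(1)]] cls[OF x(1)] unfolding bij_betw_def by blast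
    then show "v \<in> {..<m} \<times> {..<k}" using x c_less unfolding f_def by auto
  next
    fix v assume "v \<in> {..<m} \<times> {..<k}"
    then obtain a i where ai: "v = (a, i)" "a < m" "i < k" by auto
    then have "a \<in> h i ` colour_class V c i" using h unfolding bij_betw_def by auto
    then obtain x where "x \<in> colour_class V c i" "a = h i x" by blast
    then show "v \<in> f ` V" using ai(1) unfolding f_def colour_class_def by force
  qed
  have n: "n = m * k" using card_image[OF inj] V(2) unfolding img by (simp add: card_cartesian_product)
  have "star_system e (m * k) ({..<m} \<times> {..<k}) (map_graph f ` B)"
    using star_system_map[OF sys inj] unfolding img n .
  moreover have "colouring k ({..<m} \<times> {..<k}) (map_graph f ` B) snd"
  proof -
    have "snd \<circ> f = c" by (simp add: fun_eq_iff f_def)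
    then show ?thesis using colouring_map[OF sys inj, of k snd] c(1) unfolding img by simp
  qed
  moreover have "m > 0" using n V \<open>V \<noteq> {}\<close> by (metis card_0_eq mult_is_0 not_gr_zero)
  ultimately show ?thesis
    using \<open>2 * e dvd n\<close> unfolding n grid_system_def by (intro exI[of _ "{..<m}"]) auto
qed

theorem theorem4p4:
  fixes k e n\<^sub>0 :: nat
  assumes "k \<ge> 3" and "e \<ge> 3"
    and "[n\<^sub>0 = 0] (mod (2 * e))"
    and "\<exists>(V :: 'a set) B. star_system e n\<^sub>0 V B \<and> strongly_equitable_chromatic k V B"
  shows "\<exists>n. [n = 0] (mod (2 * e)) \<and>
           (\<exists>(V :: nat set) B. star_system e n V B \<and> strongly_equitable_uniquely_chromatic k V B)"
proof -
  obtain V :: "'a set" and B c where V: "star_system e n\<^sub>0 V B" "\<not> colourable (k - 1) V B"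
    "colouring k V B c" "strongly_equitable k V c"
    using assms(4) unfolding strongly_equitable_chromatic_def chromatic_def by blast
  \<comment> \<open>The empty system has no stars and is colourable with any number of colours, so
    chromaticity rules it out. Copies of an empty system could not grow.\<close>
  have "V \<noteq> {}"
  proof
    assume "V = {}"
    then have "colouring (k - 1) V B c"
      using star_system_verts_subset[OF V(1)] unfolding colouring_iff[OF V(1)] by auto
    then show False using V(2) unfolding colourable_def by blast
  qed
  moreover have "2 * e dvd n\<^sub>0" using assms(3) by (simp add: cong_0_iff)
  ultimately obtain A\<^sub>0 B\<^sub>0 where "grid_system k e A\<^sub>0 B\<^sub>0" "A\<^sub>0 \<noteq> {}"
    using grid_system_of_equitable[OF V(1,3,4)] assms(1) by auto
  then interpret grid k e A\<^sub>0 B\<^sub>0 using assms(1,2) by unfold_locales auto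
  obtain A D where A: "grid_system k e A D" "A \<noteq> {}" "\<And>c. colg A D c \<Longrightarrow> \<exists>p. forced A c p"
    using ex_forced_grid_system by blast
  note dA = grid_systemD[OF A(1)]
  \<comment> \<open>The vertices are to be natural numbers, so the grid is encoded by the pairing
    function.\<close>
  have inj: "inj_on prod_encode (A \<times> {..<k})" by (simp add: inj_prod_encode)
  define W where "W = prod_encode ` (A \<times> {..<k})"
  define C where "C = map_graph prod_encode ` D"
  define r where "r = snd \<circ> prod_decode"
  have sysW: "star_system e (card A * k) W C"
    using star_system_map[OF dA(3) inj] unfolding W_def C_def .
  have r_enc: "r \<circ> prod_encode = snd" by (simp add: r_def fun_eq_iff)
  have colW: "colouring k W C c \<longleftrightarrow> colg A D (c \<circ> prod_encode)" for c
    using colouring_map[OF dA(3) inj] unfolding W_def C_def .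
  have "strongly_equitable_uniquely_chromatic k W C"
  proof (rule strongly_equitable_uniquely_chromaticI[OF sysW])
    show "colouring k W C r" unfolding colW r_enc by (rule dA(4))
    have "colour_class W r i = prod_encode ` (A \<times> {i})" if "i < k" for i
      using that unfolding colour_class_def W_def r_def by auto
    then have "card (colour_class W r i) = card A" if "i < k" for i
      using that by (simp add: card_image inj_prod_encode card_cartesian_product)
    then show "strongly_equitable k W r" unfolding strongly_equitable_def by simp
    have "r ` W = snd ` (A \<times> {..<k})" unfolding W_def image_comp r_enc ..
    then show "r ` W = {..<k}" using A(2) by simp
    show "k \<ge> 1" using assms(1) by simp
    fix c assume "colouring k W C c"
    then obtain p where "forced A (c \<circ> prod_encode) p" using A(3) colW by blast
    then show "\<exists>p. inj_on p {..<k} \<and> p ` {..<k} \<subseteq> {..<k} \<and> (\<forall>x\<in>W. c x = p (r x))"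
      unfolding forced_def W_def r_def by auto
  qed
  moreover have "[card A * k = 0] (mod (2 * e))" using dA(2) by (simp add: cong_0_iff)
  ultimately show ?thesis using sysW by blast
qed

end
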